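(* Let $S$ be an $F$-inverse monoid. A congruence $\rho$ on $S$ is an $F$-congruence if and only if $(\ker\rho,\operatorname{tr}\rho)$ is an $F$-congruence pair for $S$. Consequently, the map $\rho\mapsto(\ker\rho,\operatorname{tr}\rho)$ is a bijection between the $F$-congruences on $S$ and the $F$-congruence pairs for $S$, with inverse $(K,\tau)\mapsto\rho_{(K,\tau)}$.
   Context: For an inverse semigroup $S$, $E(S)$ is its set of idempotents, $\leq$ is the natural partial order ($s\leq t$ iff $s=et$ for some $e\in E(S)$), and $\sigma$ is the minimum group congruence ($s\mathrel{\sigma}t$ iff $es=et$ for some $e\in E(S)$). $S$ is $F$-inverse if every $\sigma$-class has a maximum element with respect to $\leq$; such an $S$ is automatically a monoid with identity $1$, the maximum idempotent. For $a$ in an $F$-inverse monoid $S$, $a^{\mathfrak m}$ denotes the maximum element of the $\sigma$-class of $a$. A congruence on $S$ is an equivalence relation compatible with multiplication on both sides. An $F$-congruence on an $F$-inverse monoid $S$ is a congruence $\rho$ such that $a\mathrel{\rho}b$ implies $a^{\mathfrak m}\mathrel{\rho}b^{\mathfrak m}$ for all $a,b\in S$. For a congruence $\rho$ on $S$: $\operatorname{tr}\rho$ is the restriction of $\rho$ to $E(S)$, and $\ker\rho=\{a\in S: a\mathrel{\rho}e\text{ for some }e\in E(S)\}$. A normal subsemigroup of $S$ is an inverse subsemigroup $K$ of $S$ with $E(S)\subseteq K$ and $aKa^{-1}\subseteq K$ for all $a\in S$. A normal congruence on $E(S)$ is a congruence $\tau$ on the semilattice $E(S)$ such that $e\mathrel{\tau}f$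 implies $a^{-1}ea\mathrel{\tau}a^{-1}fa$ for all $e,f\in E(S)$, $a\in S$. A congruence pair for $S$ is a pair $(K,\tau)$ with $K$ a normal subsemigroup of $S$ and $\tau$ a normal congruence on $E(S)$ such that: (i) for all $a\in S$, $e\in E(S)$, if $ae\in K$ and $e\mathrel{\tau}a^{-1}a$, then $a\in K$; (ii) for all $a\in K$, $a^{-1}a\mathrel{\tau}aa^{-1}$. For a congruence pair $(K,\tau)$, the relation $\rho_{(K,\tau)}$ on $S$ is defined by: $a\mathrel{\rho_{(K,\tau)}}b$ iff $a^{-1}a\mathrel{\tau}b^{-1}b$ and $ab^{-1}\in K$. An $F$-congruence pair for an $F$-inverse monoid $S$ is a congruence pair $(K,\tau)$ for $S$ such that: (FP1) if $a\in K$, then $a^{\mathfrak m}\in K$; (FP2) if $a\in K$, then $(a^{\mathfrak m})^{-1}a^{\mathfrak m}\mathrel{\tau}1$. *)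

theory Defs
  imports "HOL-Algebra.Group"
begin

text \<open>
  Semigroups are records with carrier from HOL-Algebra; a field for the unit element
  is present in the record, but it is meaningful only once \<open>monoid\<close> is assumed.
  Relations on a carrier are sets of pairs.  The inverse of HOL-Algebra (\<open>m_inv\<close>) is the
  group-theoretic one, so the inverse in an inverse semigroup is introduced separately.
\<close>

definition is_sinverse :: "('a, 'b) monoid_scheme \<Rightarrow> 'a \<Rightarrow> 'a \<Rightarrow> bool" where
  "is_sinverse S a x \<longleftrightarrow> a \<otimes>\<^bsub>S\<^esub> x \<otimes>\<^bsub>S\<^esub> a = a \<and> x \<otimes>\<^bsub>S\<^esub> a \<otimes>\<^bsub>S\<^esub> x = x"

locale inverse_semigroup =
  fixes S :: "('a, 'b) monoid_scheme" (structure)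
  assumes mult_closed: "\<lbrakk>a \<in> carrier S; b \<in> carrier S\<rbrakk> \<Longrightarrow> a \<otimes> b \<in> carrier S"
    and mult_assoc: "\<lbrakk>a \<in> carrier S; b \<in> carrier S; c \<in> carrier S\<rbrakk>
          \<Longrightarrow> (a \<otimes> b) \<otimes> c = a \<otimes> (b \<otimes> c)"
    and ex1_sinverse: "a \<in> carrier S \<Longrightarrow> \<exists>!x. x \<in> carrier S \<and> is_sinverse S a x"

definition sinv :: "('a, 'b) monoid_scheme \<Rightarrow> 'a \<Rightarrow> 'a" (\<open>sinv\<index> _\<close> [81] 80) where
  "sinv\<^bsub>S\<^esub> a = (THE x. x \<in> carrier S \<and> is_sinverse S a x)"

definition idems :: "('a, 'b) monoid_scheme \<Rightarrow> 'a set" where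
  "idems S = {e \<in> carrier S. e \<otimes>\<^bsub>S\<^esub> e = e}"

definition nat_le :: "('a, 'b) monoid_scheme \<Rightarrow> 'a \<Rightarrow> 'a \<Rightarrow> bool" where
  "nat_le S s t \<longleftrightarrow> (\<exists>e\<in>idems S. s = e \<otimes>\<^bsub>S\<^esub> t)"

definition min_group_cong :: "('a, 'b) monoid_scheme \<Rightarrow> ('a \<times> 'a) set" where
  "min_group_cong S = {(s, t). s \<in> carrier S \<and> t \<in> carrier S \<and>
     (\<exists>e\<in>idems S. e \<otimes>\<^bsub>S\<^esub> s = e \<otimes>\<^bsub>S\<^esub> t)}"

definition is_max_of_class :: "('a, 'b) monoid_scheme \<Rightarrow> 'a \<Rightarrow> 'a \<Rightarrow> bool" where
  "is_max_of_class S a m \<longleftrightarrow> (a, m) \<in> min_group_cong S \<and>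
     (\<forall>b. (a, b) \<in> min_group_cong S \<longrightarrow> nat_le S b m)"

text \<open>
  A (nonempty) F-inverse semigroup automatically has an identity, the maximum idempotent; the
  locale \<open>monoid\<close> only ties the record field \<open>\<one>\<close> to that identity.
\<close>

locale F_inverse_monoid = inverse_semigroup S + monoid S
  for S :: "('a, 'b) monoid_scheme" (structure) +
  assumes ex_max: "a \<in> carrier S \<Longrightarrow> \<exists>m. is_max_of_class S a m"

definition cmax :: "('a, 'b) monoid_scheme \<Rightarrow> 'a \<Rightarrow> 'a" where
  "cmax S a = (THE m. is_max_of_class S a m)"

definition semigroup_congruence :: "('a, 'b) monoid_scheme \<Rightarrow> ('a \<times> 'a) set \<Rightarrow> bool" where
  "semigroup_congruence S \<rho> \<longleftrightarrow> equiv (carrier S) \<rho> \<and>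
     (\<forall>a b c. (a, b) \<in> \<rho> \<longrightarrow> c \<in> carrier S \<longrightarrow>
        (c \<otimes>\<^bsub>S\<^esub> a, c \<otimes>\<^bsub>S\<^esub> b) \<in> \<rho> \<and> (a \<otimes>\<^bsub>S\<^esub> c, b \<otimes>\<^bsub>S\<^esub> c) \<in> \<rho>)"

definition F_congruence :: "('a, 'b) monoid_scheme \<Rightarrow> ('a \<times> 'a) set \<Rightarrow> bool" where
  "F_congruence S \<rho> \<longleftrightarrow> semigroup_congruence S \<rho> \<and>
     (\<forall>a b. (a, b) \<in> \<rho> \<longrightarrow> (cmax S a, cmax S b) \<in> \<rho>)"

definition trace_cong :: "('a, 'b) monoid_scheme \<Rightarrow> ('a \<times> 'a) set \<Rightarrow> ('a \<times> 'a) set" where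
  "trace_cong S \<rho> = \<rho> \<inter> (idems S \<times> idems S)"

definition kernel_cong :: "('a, 'b) monoid_scheme \<Rightarrow> ('a \<times> 'a) set \<Rightarrow> 'a set" where
  "kernel_cong S \<rho> = {a \<in> carrier S. \<exists>e\<in>idems S. (a, e) \<in> \<rho>}"

definition inverse_subsemigroup :: "('a, 'b) monoid_scheme \<Rightarrow> 'a set \<Rightarrow> bool" where
  "inverse_subsemigroup S K \<longleftrightarrow> K \<subseteq> carrier S \<and>
     (\<forall>a\<in>K. \<forall>b\<in>K. a \<otimes>\<^bsub>S\<^esub> b \<in> K) \<and> (\<forall>a\<in>K. sinv\<^bsub>S\<^esub> a \<in> K)"

definition normal_subsemigroup :: "('a, 'b) monoid_scheme \<Rightarrow> 'a set \<Rightarrow> bool" where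
  "normal_subsemigroup S K \<longleftrightarrow> inverse_subsemigroup S K \<and> idems S \<subseteq> K \<and>
     (\<forall>a\<in>carrier S. \<forall>k\<in>K. a \<otimes>\<^bsub>S\<^esub> k \<otimes>\<^bsub>S\<^esub> sinv\<^bsub>S\<^esub> a \<in> K)"

definition normal_congruence :: "('a, 'b) monoid_scheme \<Rightarrow> ('a \<times> 'a) set \<Rightarrow> bool" where
  "normal_congruence S \<tau> \<longleftrightarrow> semigroup_congruence (S\<lparr>carrier := idems S\<rparr>) \<tau> \<and>
     (\<forall>e\<in>idems S. \<forall>f\<in>idems S. \<forall>a\<in>carrier S. (e, f) \<in> \<tau> \<longrightarrow>
        (sinv\<^bsub>S\<^esub> a \<otimes>\<^bsub>S\<^esub> e \<otimes>\<^bsub>S\<^esub> a, sinv\<^bsub>S\<^esub> a \<otimes>\<^bsub>S\<^esub> f \<otimes>\<^bsub>S\<^esub> a) \<in> \<tau>)"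

definition congruence_pair :: "('a, 'b) monoid_scheme \<Rightarrow> 'a set \<Rightarrow> ('a \<times> 'a) set \<Rightarrow> bool" where
  "congruence_pair S K \<tau> \<longleftrightarrow> normal_subsemigroup S K \<and> normal_congruence S \<tau> \<and>
     (\<forall>a\<in>carrier S. \<forall>e\<in>idems S.
        a \<otimes>\<^bsub>S\<^esub> e \<in> K \<longrightarrow> (e, sinv\<^bsub>S\<^esub> a \<otimes>\<^bsub>S\<^esub> a) \<in> \<tau> \<longrightarrow> a \<in> K) \<and>
     (\<forall>a\<in>K. (sinv\<^bsub>S\<^esub> a \<otimes>\<^bsub>S\<^esub> a, a \<otimes>\<^bsub>S\<^esub> sinv\<^bsub>S\<^esub> a) \<in> \<tau>)"

definition pair_cong :: "('a, 'b) monoid_scheme \<Rightarrow> 'a set \<Rightarrow> ('a \<times> 'a) set \<Rightarrow> ('a \<times> 'a) set" where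
  "pair_cong S K \<tau> = {(a, b). a \<in> carrier S \<and> b \<in> carrier S \<and>
     (sinv\<^bsub>S\<^esub> a \<otimes>\<^bsub>S\<^esub> a, sinv\<^bsub>S\<^esub> b \<otimes>\<^bsub>S\<^esub> b) \<in> \<tau> \<and> a \<otimes>\<^bsub>S\<^esub> sinv\<^bsub>S\<^esub> b \<in> K}"

definition F_congruence_pair :: "('a, 'b) monoid_scheme \<Rightarrow> 'a set \<Rightarrow> ('a \<times> 'a) set \<Rightarrow> bool" where
  "F_congruence_pair S K \<tau> \<longleftrightarrow> congruence_pair S K \<tau> \<and>
     (\<forall>a\<in>K. cmax S a \<in> K) \<and>
     (\<forall>a\<in>K. (sinv\<^bsub>S\<^esub> (cmax S a) \<otimes>\<^bsub>S\<^esub> cmax S a, \<one>\<^bsub>S\<^esub>) \<in> \<tau>)"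

end

theory Submission
  imports Defs
begin

text \<open>
  The result rests on the kernel-trace description of congruences on an inverse semigroup: a
  congruence \<open>\<rho>\<close> is recovered from its kernel and trace, since \<open>a \<rho> b\<close> exactly when
  \<open>a\<inverse> a \<rho> b\<inverse> b\<close> and \<open>a b\<inverse>\<close> is related to an idempotent (\<open>pair_cong_kernel_trace\<close>);
  conversely the relation defined by a congruence pair is a congruence with the given kernel and
  trace (\<open>semigroup_congruence_pair_cong\<close>, \<open>kernel_pair_cong\<close>, \<open>trace_pair_cong\<close>).  The
  only hard point there is left compatibility, which needs that related elements conjugate an
  idempotent to \<open>\<tau>\<close>-related idempotents (\<open>rel_conj_pair\<close>).

  This correspondence restricts to F-congruences and F-congruence pairs.  If \<open>\<rho>\<close> is an
  F-congruence and \<open>a \<rho> e\<close> with \<open>e\<close> idempotent, then \<open>a\<^sup>\<mm> \<rho> e\<^sup>\<mm> = 1\<close>, which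
  gives both conditions on the pair.  Conversely, the two conditions together say that
  \<open>g\<^sup>\<mm> \<rho> 1\<close> for every \<open>g\<close> in the kernel.  If \<open>a \<rho> b\<close>, then \<open>a b\<inverse>\<close> is in the
  kernel, and multiplying \<open>b\<^sup>\<mm>\<close> by \<open>(a b\<inverse>)\<^sup>\<mm>\<close> moves it into the \<open>\<sigma>\<close>-class of
  \<open>a\<close> without changing its \<open>\<rho>\<close>-class.  Hence in \<open>S / \<rho>\<close> the class of \<open>b\<^sup>\<mm>\<close> is
  below that of \<open>a\<^sup>\<mm>\<close> (\<open>cmax_below\<close>); by symmetry the two classes are equal.
\<close>

section \<open>Inverses and idempotents\<close>

context inverse_semigroup
begin

lemma sinv_props:
  assumes "a \<in> carrier S"
  shows "sinv a \<in> carrier S" "is_sinverse S a (sinv a)"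
  using theI'[OF ex1_sinverse[OF assms]] unfolding sinv_def by auto

lemma sinv_closed [simp, intro]: "a \<in> carrier S \<Longrightarrow> sinv a \<in> carrier S"
  by (rule sinv_props)

lemma closed [simp, intro]: "a \<in> carrier S \<Longrightarrow> b \<in> carrier S \<Longrightarrow> a \<otimes> b \<in> carrier S"
  by (rule mult_closed)

lemma sinv_unique:
  assumes "a \<in> carrier S" "x \<in> carrier S" "a \<otimes> x \<otimes> a = a" "x \<otimes> a \<otimes> x = x"
  shows "sinv a = x"
  using ex1_sinverse[OF assms(1)] sinv_props[OF assms(1)] assms
  unfolding is_sinverse_def by blast

lemma mult_sinv_mult:
  assumes "a \<in> carrier S"
  shows "a \<otimes> (sinv a \<otimes> a) = a" "sinv a \<otimes> (a \<otimes> sinv a) = sinv a"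
  using sinv_props[OF assms] assms unfolding is_sinverse_def by (simp_all add: mult_assoc)

lemma mult_sinv_mult_left:
  assumes "a \<in> carrier S" "x \<in> carrier S"
  shows "a \<otimes> (sinv a \<otimes> (a \<otimes> x)) = a \<otimes> x" "sinv a \<otimes> (a \<otimes> (sinv a \<otimes> x)) = sinv a \<otimes> x"
  using mult_sinv_mult[OF assms(1)] assms
  by (simp_all add: mult_assoc[symmetric])

lemma sinv_sinv [simp]: "a \<in> carrier S \<Longrightarrow> sinv (sinv a) = a"
  by (rule sinv_unique) (auto simp: mult_assoc mult_sinv_mult)

lemma idems_closed [simp, intro]: "e \<in> idems S \<Longrightarrow> e \<in> carrier S"
  by (simp add: idems_def)

lemma idem_mult_self: "e \<in> idems S \<Longrightarrow> e \<otimes> e = e"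
  by (simp add: idems_def del: idems_closed)

lemma idem_mult_self_left: "e \<in> idems S \<Longrightarrow> x \<in> carrier S \<Longrightarrow> e \<otimes> (e \<otimes> x) = e \<otimes> x"
  by (simp add: mult_assoc[symmetric] idem_mult_self)

lemma idemI: "e \<in> carrier S \<Longrightarrow> e \<otimes> e = e \<Longrightarrow> e \<in> idems S"
  by (simp add: idems_def del: idems_closed)

lemma sinv_idem [simp]: "e \<in> idems S \<Longrightarrow> sinv e = e"
  by (rule sinv_unique) (auto simp: idem_mult_self)

text \<open>
  Uniqueness of inverses forces \<open>x = f x e\<close> for the inverse \<open>x\<close> of a product \<open>e f\<close> of
  idempotents, since \<open>f x e\<close> is also an inverse of it.  Such an \<open>x\<close> is idempotent, hence is its
  own inverse, and so equals \<open>e f\<close>.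
\<close>

lemma idem_mult_idem:
  assumes e: "e \<in> idems S" and f: "f \<in> idems S"
  shows "e \<otimes> f \<in> idems S"
proof -
  define x where "x = sinv (e \<otimes> f)"
  have c: "e \<in> carrier S" "f \<in> carrier S" "x \<in> carrier S"
    using e f unfolding x_def by auto
  note ee = idem_mult_self[OF e] idem_mult_self_left[OF e]
    idem_mult_self[OF f] idem_mult_self_left[OF f]
  have 1: "e \<otimes> (f \<otimes> (x \<otimes> (e \<otimes> f))) = e \<otimes> f"
    using mult_sinv_mult(1)[of "e \<otimes> f"] c by (simp add: x_def[symmetric] mult_assoc)
  have 2: "x \<otimes> (e \<otimes> (f \<otimes> x)) = x"
    using mult_sinv_mult(2)[of "e \<otimes> f"] c by (simp add: x_def[symmetric] mult_assoc)
  have 3: "x \<otimes> (e \<otimes> (f \<otimes> (x \<otimes> e))) = x \<otimes> e"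
    using arg_cong[OF 2, of "\<lambda>y. y \<otimes> e"] c by (simp add: mult_assoc)
  have "sinv (e \<otimes> f) = f \<otimes> x \<otimes> e"
    by (rule sinv_unique) (use c in \<open>simp_all add: mult_assoc ee 1 3\<close>)
  hence x: "x = f \<otimes> x \<otimes> e" unfolding x_def[symmetric] .
  have "x \<otimes> x = (f \<otimes> x \<otimes> e) \<otimes> (f \<otimes> x \<otimes> e)" by (rule arg_cong2[OF x x])
  also have "\<dots> = f \<otimes> x \<otimes> e" using c by (simp add: mult_assoc 3)
  also note x[symmetric]
  finally have "x \<in> idems S" using c by (intro idemI)
  moreover from this have "e \<otimes> f = x"
    using sinv_sinv[of "e \<otimes> f"] c by (simp add: x_def[symmetric])
  ultimately show ?thesis by simp
qed

lemma idem_commute: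
  assumes e: "e \<in> idems S" and f: "f \<in> idems S"
  shows "e \<otimes> f = f \<otimes> e"
proof -
  have c: "e \<in> carrier S" "f \<in> carrier S" using e f by auto
  note ee = idem_mult_self[OF e] idem_mult_self_left[OF e]
    idem_mult_self[OF f] idem_mult_self_left[OF f]
  have "sinv (e \<otimes> f) = f \<otimes> e"
    using idem_mult_self[OF idem_mult_idem[OF e f]] idem_mult_self[OF idem_mult_idem[OF f e]] c
    by (intro sinv_unique) (simp_all add: mult_assoc ee)
  thus ?thesis using sinv_idem[OF idem_mult_idem[OF e f]] by simp
qed

lemma idem_left_commute:
  "e \<in> idems S \<Longrightarrow> f \<in> idems S \<Longrightarrow> x \<in> carrier S \<Longrightarrow> e \<otimes> (f \<otimes> x) = f \<otimes> (e \<otimes> x)"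
  by (simp add: mult_assoc[symmetric] idem_commute[of e f])

lemma sinv_mult_idem [simp]: "a \<in> carrier S \<Longrightarrow> sinv a \<otimes> a \<in> idems S"
  by (rule idemI) (auto simp: mult_assoc mult_sinv_mult)

lemma mult_sinv_idem [simp]: "a \<in> carrier S \<Longrightarrow> a \<otimes> sinv a \<in> idems S"
  by (rule idemI) (auto simp: mult_assoc mult_sinv_mult)

text \<open>Moving an idempotent past an element conjugates it.\<close>

lemma idem_push_right:
  assumes "a \<in> carrier S" "e \<in> idems S"
  shows "a \<otimes> sinv a \<otimes> e \<otimes> a = e \<otimes> a"
proof -
  have "a \<otimes> sinv a \<otimes> e \<otimes> a = e \<otimes> (a \<otimes> sinv a) \<otimes> a"
    using idem_commute[OF mult_sinv_idem[OF assms(1)] assms(2)] by simp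
  also have "\<dots> = e \<otimes> a" using assms by (simp add: mult_assoc mult_sinv_mult)
  finally show ?thesis .
qed

lemma idem_push_left:
  assumes "a \<in> carrier S" "e \<in> idems S"
  shows "a \<otimes> e \<otimes> sinv a \<otimes> a = a \<otimes> e"
proof -
  have "a \<otimes> e \<otimes> sinv a \<otimes> a = a \<otimes> (e \<otimes> (sinv a \<otimes> a))"
    using assms by (simp add: mult_assoc)
  also have "\<dots> = a \<otimes> ((sinv a \<otimes> a) \<otimes> e)"
    using idem_commute[OF sinv_mult_idem[OF assms(1)] assms(2)] by simp
  also have "\<dots> = a \<otimes> e" using assms by (simp add: mult_assoc mult_sinv_mult_left)
  finally show ?thesis .
qed

lemma conj_idem:
  assumes "a \<in> carrier S" "e \<in> idems S"
  shows "a \<otimes> e \<otimes> sinv a \<in> idems S"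
proof (rule idemI)
  have "(a \<otimes> e \<otimes> sinv a) \<otimes> (a \<otimes> e \<otimes> sinv a) = (a \<otimes> e \<otimes> sinv a \<otimes> a) \<otimes> (e \<otimes> sinv a)"
    using assms by (simp add: mult_assoc)
  thus "(a \<otimes> e \<otimes> sinv a) \<otimes> (a \<otimes> e \<otimes> sinv a) = a \<otimes> e \<otimes> sinv a"
    using assms by (simp add: idem_push_left) (simp add: mult_assoc idem_mult_self_left)
qed (use assms in auto)

lemma conj_idem': "a \<in> carrier S \<Longrightarrow> e \<in> idems S \<Longrightarrow> sinv a \<otimes> e \<otimes> a \<in> idems S"
  using conj_idem[of "sinv a" e] by simp

lemma sinv_mult:
  assumes a: "a \<in> carrier S" and b: "b \<in> carrier S"
  shows "sinv (a \<otimes> b) = sinv b \<otimes> sinv a"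
proof (rule sinv_unique)
  have comm: "(b \<otimes> sinv b) \<otimes> (sinv a \<otimes> a) = (sinv a \<otimes> a) \<otimes> (b \<otimes> sinv b)"
    using a b by (intro idem_commute) auto
  have "a \<otimes> b \<otimes> (sinv b \<otimes> sinv a) \<otimes> (a \<otimes> b) = a \<otimes> ((b \<otimes> sinv b) \<otimes> (sinv a \<otimes> a)) \<otimes> b"
    using a b by (simp add: mult_assoc)
  also have "\<dots> = a \<otimes> b"
    unfolding comm using a b by (simp add: mult_assoc mult_sinv_mult mult_sinv_mult_left)
  finally show "a \<otimes> b \<otimes> (sinv b \<otimes> sinv a) \<otimes> (a \<otimes> b) = a \<otimes> b" .
  have "sinv b \<otimes> sinv a \<otimes> (a \<otimes> b) \<otimes> (sinv b \<otimes> sinv a)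
      = sinv b \<otimes> ((sinv a \<otimes> a) \<otimes> (b \<otimes> sinv b)) \<otimes> sinv a"
    using a b by (simp add: mult_assoc)
  also have "\<dots> = sinv b \<otimes> sinv a"
    unfolding comm[symmetric] using a b
    by (simp add: mult_assoc mult_sinv_mult mult_sinv_mult_left)
  finally show "sinv b \<otimes> sinv a \<otimes> (a \<otimes> b) \<otimes> (sinv b \<otimes> sinv a) = sinv b \<otimes> sinv a" .
qed (use a b in auto)

end

section \<open>From a congruence to its kernel and trace\<close>

locale inverse_semigroup_cong = inverse_semigroup S
  for S :: "('a, 'b) monoid_scheme" (structure) +
  fixes \<rho> :: "('a \<times> 'a) set"
  assumes cong: "semigroup_congruence S \<rho>"
begin

text \<open>
  A constant of its own lets calculational proofs chain relatedness with equations: the last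
  argument is then the right-hand element, and not the relation \<open>\<rho>\<close>.
\<close>

definition related (infix \<open>\<approx>\<close> 50) where "a \<approx> b \<longleftrightarrow> (a, b) \<in> \<rho>"

lemma rel_carrier: assumes "a \<approx> b" shows "a \<in> carrier S" "b \<in> carrier S"
  using cong assms unfolding related_def semigroup_congruence_def equiv_def refl_on_def by auto

lemma rel_refl [simp, intro]: "a \<in> carrier S \<Longrightarrow> a \<approx> a"
  using cong unfolding related_def semigroup_congruence_def equiv_def refl_on_def by auto

lemma rel_sym: "a \<approx> b \<Longrightarrow> b \<approx> a"
  using cong unfolding related_def semigroup_congruence_def equiv_def sym_def by blast

lemma rel_trans [trans]: "a \<approx> b \<Longrightarrow> b \<approx> c \<Longrightarrow> a \<approx> c"
  using cong unfolding related_def semigroup_congruence_def equiv_def trans_def by blast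

lemma rel_mult:
  assumes "a \<approx> b" "c \<approx> d"
  shows "a \<otimes> c \<approx> b \<otimes> d"
proof -
  have "a \<otimes> c \<approx> b \<otimes> c" "b \<otimes> c \<approx> b \<otimes> d"
    using cong assms rel_carrier[OF assms(1)] rel_carrier[OF assms(2)]
    unfolding related_def semigroup_congruence_def by auto
  thus ?thesis by (rule rel_trans)
qed

text \<open>
  Modulo a congruence, \<open>a\<inverse>\<close> and \<open>b\<inverse>\<close> are inverses of the same element; the next three
  lemmas carry the proof of uniqueness of inverses over to the quotient, using that the domain
  idempotents of \<open>a\<close> and \<open>b\<close>, and likewise their range idempotents, commute.
\<close>

lemma rel_sinv_mult:
  assumes ab: "a \<approx> b"
  shows "sinv a \<otimes> a \<approx> sinv b \<otimes> b"
proof -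
  have a: "a \<in> carrier S" and b: "b \<in> carrier S" using rel_carrier[OF ab] by auto
  have ba: "b \<approx> a" using ab by (rule rel_sym)
  have "sinv a \<otimes> a \<approx> sinv a \<otimes> b" using ab a by (intro rel_mult) auto
  also have "sinv a \<otimes> b = sinv a \<otimes> b \<otimes> (sinv b \<otimes> b)"
    using a b by (simp add: mult_assoc mult_sinv_mult)
  also have "\<dots> \<approx> sinv a \<otimes> a \<otimes> (sinv b \<otimes> b)" using ba a b by (intro rel_mult) auto
  also have "\<dots> = sinv b \<otimes> b \<otimes> (sinv a \<otimes> a)" using a b by (intro idem_commute) auto
  also have "\<dots> \<approx> sinv b \<otimes> a \<otimes> (sinv a \<otimes> a)" using ba a b by (intro rel_mult) auto
  also have "\<dots> = sinv b \<otimes> a" using a b by (simp add: mult_assoc mult_sinv_mult)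
  also have "\<dots> \<approx> sinv b \<otimes> b" using ab b by (intro rel_mult) auto
  finally show ?thesis .
qed

lemma rel_mult_sinv:
  assumes ab: "a \<approx> b"
  shows "a \<otimes> sinv a \<approx> b \<otimes> sinv b"
proof -
  have a: "a \<in> carrier S" and b: "b \<in> carrier S" using rel_carrier[OF ab] by auto
  have ba: "b \<approx> a" using ab by (rule rel_sym)
  have "a \<otimes> sinv a \<approx> b \<otimes> sinv a" using ab a by (intro rel_mult) auto
  also have "b \<otimes> sinv a = b \<otimes> sinv b \<otimes> (b \<otimes> sinv a)"
    using a b by (simp add: mult_assoc mult_sinv_mult_left)
  also have "\<dots> \<approx> b \<otimes> sinv b \<otimes> (a \<otimes> sinv a)" using ba a b by (intro rel_mult) auto
  also have "\<dots> = a \<otimes> sinv a \<otimes> (b \<otimes> sinv b)" using a b by (intro idem_commute) auto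
  also have "\<dots> \<approx> a \<otimes> sinv a \<otimes> (a \<otimes> sinv b)" using ba a b by (intro rel_mult) auto
  also have "\<dots> = a \<otimes> sinv b" using a b by (simp add: mult_assoc mult_sinv_mult_left)
  also have "\<dots> \<approx> b \<otimes> sinv b" using ab b by (intro rel_mult) auto
  finally show ?thesis .
qed

lemma rel_sinv:
  assumes ab: "a \<approx> b"
  shows "sinv a \<approx> sinv b"
proof -
  have a: "a \<in> carrier S" and b: "b \<in> carrier S" using rel_carrier[OF ab] by auto
  have "sinv a = sinv a \<otimes> (a \<otimes> sinv a)" using a by (simp add: mult_sinv_mult)
  also have "\<dots> \<approx> sinv a \<otimes> (b \<otimes> sinv b)" using rel_mult[OF rel_refl rel_mult_sinv[OF ab]] a by simp
  also have "\<dots> \<approx> sinv a \<otimes> (a \<otimes> sinv b)" using rel_sym[OF ab] a b by (intro rel_mult) auto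
  also have "\<dots> = sinv a \<otimes> a \<otimes> sinv b" using a b by (simp add: mult_assoc)
  also have "\<dots> \<approx> sinv b \<otimes> b \<otimes> sinv b" using rel_mult[OF rel_sinv_mult[OF ab] rel_refl] b by simp
  also have "\<dots> = sinv b" using b by (simp add: mult_assoc mult_sinv_mult)
  finally show ?thesis .
qed

lemma kernelI: "a \<approx> e \<Longrightarrow> e \<in> idems S \<Longrightarrow> a \<in> kernel_cong S \<rho>"
  using rel_carrier unfolding kernel_cong_def related_def by auto

lemma kernelE:
  assumes "a \<in> kernel_cong S \<rho>"
  obtains e where "a \<in> carrier S" "e \<in> idems S" "a \<approx> e"
  using assms unfolding kernel_cong_def related_def by auto

lemma trace_iff: "(e, f) \<in> trace_cong S \<rho> \<longleftrightarrow> e \<approx> f \<and> e \<in> idems S \<and> f \<in> idems S"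
  unfolding trace_cong_def related_def by auto

lemma kernel_normal: "normal_subsemigroup S (kernel_cong S \<rho>)"
  unfolding normal_subsemigroup_def inverse_subsemigroup_def
proof (intro conjI ballI subsetI)
  fix a b assume "a \<in> kernel_cong S \<rho>" "b \<in> kernel_cong S \<rho>"
  then show "a \<otimes> b \<in> kernel_cong S \<rho>"
    by (meson idem_mult_idem kernelE kernelI rel_mult)
next
  fix a assume "a \<in> kernel_cong S \<rho>"
  then show "sinv a \<in> kernel_cong S \<rho>"
    by (metis kernelE kernelI rel_sinv sinv_idem)
next
  fix a k assume a: "a \<in> carrier S" and "k \<in> kernel_cong S \<rho>"
  then obtain e where "e \<in> idems S" "k \<approx> e" by (auto elim: kernelE)
  with a show "a \<otimes> k \<otimes> sinv a \<in> kernel_cong S \<rho>"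
    by (intro kernelI[where e = "a \<otimes> e \<otimes> sinv a"] rel_mult conj_idem) auto
qed (auto elim: kernelE intro: kernelI)

lemma trace_normal: "normal_congruence S (trace_cong S \<rho>)"
proof -
  have "equiv (idems S) (trace_cong S \<rho>)"
    by (intro equivI refl_onI symI transI) (auto simp: trace_iff intro: rel_sym rel_trans)
  moreover have "(c \<otimes> a, c \<otimes> b) \<in> trace_cong S \<rho> \<and> (a \<otimes> c, b \<otimes> c) \<in> trace_cong S \<rho>"
    if "(a, b) \<in> trace_cong S \<rho>" "c \<in> idems S" for a b c
    using that by (auto simp: trace_iff idem_mult_idem intro!: rel_mult)
  moreover have "(sinv a \<otimes> e \<otimes> a, sinv a \<otimes> f \<otimes> a) \<in> trace_cong S \<rho>"
    if "(e, f) \<in> trace_cong S \<rho>" "a \<in> carrier S" for a e f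
    using that by (auto simp: trace_iff conj_idem' intro!: rel_mult)
  ultimately show ?thesis
    unfolding normal_congruence_def semigroup_congruence_def by auto
qed

lemma congruence_pair_kernel_trace: "congruence_pair S (kernel_cong S \<rho>) (trace_cong S \<rho>)"
  unfolding congruence_pair_def
proof (intro conjI ballI impI kernel_normal trace_normal)
  fix a e assume a: "a \<in> carrier S" and e: "e \<in> idems S" and ae: "a \<otimes> e \<in> kernel_cong S \<rho>"
    and "(e, sinv a \<otimes> a) \<in> trace_cong S \<rho>"
  hence t: "sinv a \<otimes> a \<approx> e" by (auto simp: trace_iff intro: rel_sym)
  from ae obtain f where f: "f \<in> idems S" "a \<otimes> e \<approx> f" by (auto elim: kernelE)
  have "a = a \<otimes> (sinv a \<otimes> a)" using a by (simp add: mult_sinv_mult)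
  also have "\<dots> \<approx> a \<otimes> e" using rel_mult[OF rel_refl t] a by simp
  also note \<open>a \<otimes> e \<approx> f\<close>
  finally show "a \<in> kernel_cong S \<rho>" using f by (auto intro: kernelI)
next
  fix a assume "a \<in> kernel_cong S \<rho>"
  then obtain e where e: "a \<in> carrier S" "e \<in> idems S" "a \<approx> e" by (rule kernelE)
  have "sinv a \<otimes> a \<approx> e" using rel_sinv_mult[OF e(3)] e(2) by (simp add: idem_mult_self)
  moreover have "a \<otimes> sinv a \<approx> e" using rel_mult_sinv[OF e(3)] e(2) by (simp add: idem_mult_self)
  ultimately show "(sinv a \<otimes> a, a \<otimes> sinv a) \<in> trace_cong S \<rho>"
    using e by (auto simp: trace_iff intro: rel_sym rel_trans)
qed

text \<open>
  If \<open>a b\<inverse> \<rho> f\<close> with \<open>f\<close> idempotent, and the domain idempotents of \<open>a\<close> and \<open>b\<close> are related,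
  then modulo \<open>\<rho>\<close> each of \<open>a\<close> and \<open>b\<close> is \<open>f\<close> times the other, so both are equal to \<open>f a\<close>.
\<close>

lemma pair_cong_kernel_trace: "pair_cong S (kernel_cong S \<rho>) (trace_cong S \<rho>) = \<rho>"
proof (intro equalityI subrelI)
  fix a b assume "(a, b) \<in> pair_cong S (kernel_cong S \<rho>) (trace_cong S \<rho>)"
  then obtain f where a: "a \<in> carrier S" and b: "b \<in> carrier S"
    and t: "sinv a \<otimes> a \<approx> sinv b \<otimes> b" and f: "f \<in> idems S" and abf: "a \<otimes> sinv b \<approx> f"
    by (auto simp: pair_cong_def trace_iff elim: kernelE)
  have baf: "b \<otimes> sinv a \<approx> f"
    using rel_sinv[OF abf] a b f by (simp add: sinv_mult)
  have "a = a \<otimes> (sinv a \<otimes> a)" using a by (simp add: mult_sinv_mult)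
  also have "\<dots> \<approx> a \<otimes> (sinv b \<otimes> b)" using rel_mult[OF rel_refl t] a by simp
  also have "\<dots> = a \<otimes> sinv b \<otimes> b" using a b by (simp add: mult_assoc)
  also have "\<dots> \<approx> f \<otimes> b" using abf b by (intro rel_mult) auto
  finally have afb: "a \<approx> f \<otimes> b" .
  have "b = b \<otimes> (sinv b \<otimes> b)" using b by (simp add: mult_sinv_mult)
  also have "\<dots> \<approx> b \<otimes> (sinv a \<otimes> a)" using rel_mult[OF rel_refl rel_sym[OF t]] b by simp
  also have "\<dots> = b \<otimes> sinv a \<otimes> a" using a b by (simp add: mult_assoc)
  also have "\<dots> \<approx> f \<otimes> a" using baf a by (intro rel_mult) auto
  finally have bfa: "b \<approx> f \<otimes> a" .
  note afb
  also have "f \<otimes> b \<approx> f \<otimes> (f \<otimes> a)" using bfa f by (intro rel_mult) auto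
  also have "\<dots> = f \<otimes> a" using f a by (simp add: idem_mult_self_left)
  also have "\<dots> \<approx> b" using bfa by (rule rel_sym)
  finally show "(a, b) \<in> \<rho>" by (simp add: related_def)
next
  fix a b assume "(a, b) \<in> \<rho>"
  hence ab: "a \<approx> b" by (simp add: related_def)
  have a: "a \<in> carrier S" and b: "b \<in> carrier S" using rel_carrier[OF ab] by auto
  have "a \<otimes> sinv b \<approx> b \<otimes> sinv b" using ab b by (intro rel_mult) auto
  hence "a \<otimes> sinv b \<in> kernel_cong S \<rho>" using b by (intro kernelI) auto
  thus "(a, b) \<in> pair_cong S (kernel_cong S \<rho>) (trace_cong S \<rho>)"
    using a b rel_sinv_mult[OF ab] by (auto simp: pair_cong_def trace_iff)
qed

end

section \<open>From a congruence pair to a congruence\<close>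

locale inverse_semigroup_pair = inverse_semigroup S
  for S :: "('a, 'b) monoid_scheme" (structure) +
  fixes K :: "'a set" and \<tau> :: "('a \<times> 'a) set"
  assumes pair: "congruence_pair S K \<tau>"
begin

definition related (infix \<open>\<approx>\<close> 50) where "e \<approx> f \<longleftrightarrow> (e, f) \<in> \<tau>"

lemma K_normal: "normal_subsemigroup S K"
  using pair unfolding congruence_pair_def by (elim conjE)

lemma K_carrier [simp, intro]: "a \<in> K \<Longrightarrow> a \<in> carrier S"
  and K_mult: "a \<in> K \<Longrightarrow> b \<in> K \<Longrightarrow> a \<otimes> b \<in> K"
  and K_sinv: "a \<in> K \<Longrightarrow> sinv a \<in> K"
  and K_idem: "e \<in> idems S \<Longrightarrow> e \<in> K"
  and K_conj: "a \<in> carrier S \<Longrightarrow> k \<in> K \<Longrightarrow> a \<otimes> k \<otimes> sinv a \<in> K"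
  using K_normal unfolding normal_subsemigroup_def inverse_subsemigroup_def by blast+

lemma K_cancel:
  "a \<in> carrier S \<Longrightarrow> e \<in> idems S \<Longrightarrow> a \<otimes> e \<in> K \<Longrightarrow> e \<approx> sinv a \<otimes> a \<Longrightarrow> a \<in> K"
  using pair unfolding related_def congruence_pair_def by metis

lemma K_swap: "a \<in> K \<Longrightarrow> sinv a \<otimes> a \<approx> a \<otimes> sinv a"
  using pair unfolding related_def congruence_pair_def by metis

lemma trace_normal: "normal_congruence S \<tau>"
  using pair unfolding congruence_pair_def by (elim conjE)

lemma trace_congruence: "semigroup_congruence (S\<lparr>carrier := idems S\<rparr>) \<tau>"
  using trace_normal unfolding normal_congruence_def by (rule conjunct1)

lemma trace_equiv: "equiv (idems S) \<tau>"
  using trace_congruence unfolding semigroup_congruence_def by simp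

lemma rel_mult_idem:
  assumes "e \<approx> f" "g \<in> idems S"
  shows "g \<otimes> e \<approx> g \<otimes> f" "e \<otimes> g \<approx> f \<otimes> g"
  using trace_congruence assms unfolding semigroup_congruence_def related_def by simp_all

lemma rel_idem: assumes "e \<approx> f" shows "e \<in> idems S" "f \<in> idems S"
  using equiv_type[OF trace_equiv] assms unfolding related_def by blast+

lemma rel_refl [intro]: "e \<in> idems S \<Longrightarrow> e \<approx> e"
  using trace_equiv unfolding related_def equiv_def refl_on_def by blast

lemma rel_sym: "e \<approx> f \<Longrightarrow> f \<approx> e"
  using trace_equiv unfolding related_def equiv_def sym_def by blast

lemma rel_trans [trans]: "e \<approx> f \<Longrightarrow> f \<approx> g \<Longrightarrow> e \<approx> g"
  using trace_equiv unfolding related_def equiv_def trans_def by blast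

lemma rel_conj:
  assumes "e \<approx> f" "a \<in> carrier S"
  shows "sinv a \<otimes> e \<otimes> a \<approx> sinv a \<otimes> f \<otimes> a"
  using trace_normal assms rel_idem[OF assms(1)] unfolding related_def normal_congruence_def by metis

text \<open>
  An idempotent between two factors can be inserted because \<open>a e b = (a e a\<inverse>) (a b)\<close>.  It can be
  removed when \<open>e \<tau> a\<inverse> a\<close>, because \<open>a e b = (a b) (b\<inverse> e b)\<close> and
  \<open>b\<inverse> e b \<tau> (a b)\<inverse> (a b)\<close>, so that the cancellation condition on the pair applies.
\<close>

lemma K_insert_idem:
  assumes a: "a \<in> carrier S" and b: "b \<in> carrier S" and e: "e \<in> idems S" and ab: "a \<otimes> b \<in> K"
  shows "a \<otimes> e \<otimes> b \<in> K"
proof -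
  have "(a \<otimes> e \<otimes> sinv a) \<otimes> (a \<otimes> b) \<in> K"
    using K_mult[OF K_idem[OF conj_idem[OF a e]] ab] .
  moreover have "(a \<otimes> e \<otimes> sinv a) \<otimes> (a \<otimes> b) = (a \<otimes> e \<otimes> sinv a \<otimes> a) \<otimes> b"
    using a b e by (simp add: mult_assoc)
  ultimately show ?thesis using a e by (simp add: idem_push_left)
qed

lemma K_remove_idem:
  assumes a: "a \<in> carrier S" and b: "b \<in> carrier S" and aeb: "a \<otimes> e \<otimes> b \<in> K"
    and e: "e \<approx> sinv a \<otimes> a"
  shows "a \<otimes> b \<in> K"
proof (rule K_cancel)
  have ei: "e \<in> idems S" using rel_idem[OF e] by simp
  show "sinv b \<otimes> e \<otimes> b \<in> idems S" using b ei by (rule conj_idem')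
  have "a \<otimes> b \<otimes> (sinv b \<otimes> e \<otimes> b) = a \<otimes> (b \<otimes> sinv b \<otimes> e \<otimes> b)"
    using a b ei by (simp add: mult_assoc)
  also have "\<dots> = a \<otimes> e \<otimes> b" using a b ei by (simp add: idem_push_right) (simp add: mult_assoc)
  finally show "a \<otimes> b \<otimes> (sinv b \<otimes> e \<otimes> b) \<in> K" using aeb by simp
  show "sinv b \<otimes> e \<otimes> b \<approx> sinv (a \<otimes> b) \<otimes> (a \<otimes> b)"
    using rel_conj[OF e b] a b by (simp add: sinv_mult mult_assoc)
qed (use a b in auto)

text \<open>
  For \<open>a \<in> K\<close> also \<open>e a \<in> K\<close>, and its domain and range idempotents are \<open>a\<inverse> e a\<close> and
  \<open>e a a\<inverse>\<close>: modulo \<open>\<tau>\<close>, conjugation by an element of \<open>K\<close> only restricts an idempotent.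
\<close>

lemma rel_conj_K:
  assumes a: "a \<in> K" and e: "e \<in> idems S"
  shows "sinv a \<otimes> e \<otimes> a \<approx> sinv a \<otimes> a \<otimes> e"
proof -
  have ac: "a \<in> carrier S" using a by simp
  have ea: "e \<otimes> a \<in> K" using K_mult[OF K_idem[OF e] a] .
  have "sinv a \<otimes> e \<otimes> a = sinv (e \<otimes> a) \<otimes> (e \<otimes> a)"
    using ac e by (simp add: sinv_mult mult_assoc idem_mult_self_left)
  also have "\<dots> \<approx> (e \<otimes> a) \<otimes> sinv (e \<otimes> a)" using ea by (rule K_swap)
  also have "\<dots> = e \<otimes> (a \<otimes> sinv a \<otimes> e)" using ac e by (simp add: sinv_mult mult_assoc)
  also have "\<dots> = e \<otimes> (e \<otimes> (a \<otimes> sinv a))"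
    using idem_commute[OF e mult_sinv_idem[OF ac]] by simp
  also have "\<dots> = e \<otimes> (a \<otimes> sinv a)" using ac e by (simp add: idem_mult_self_left)
  also have "\<dots> = a \<otimes> sinv a \<otimes> e" using ac e by (intro idem_commute) auto
  also have "\<dots> \<approx> sinv a \<otimes> a \<otimes> e" by (rule rel_mult_idem(2)[OF rel_sym[OF K_swap[OF a]] e])
  finally show ?thesis .
qed

text \<open>
  The delicate point in left compatibility of the relation defined by \<open>(K, \<tau>)\<close>: conjugation of
  idempotents by related elements agrees modulo \<open>\<tau>\<close>.  It follows from \<open>rel_conj_K\<close> for
  \<open>a b\<inverse> \<in> K\<close>, conjugated once more by \<open>b\<close>; the factors \<open>a\<inverse> a\<close> and \<open>b\<inverse> b\<close> that
  appear on the two sides are interchangeable modulo \<open>\<tau>\<close> and are then absorbed.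
\<close>

lemma rel_conj_pair:
  assumes a: "a \<in> carrier S" and b: "b \<in> carrier S" and e: "e \<in> idems S"
    and t: "sinv a \<otimes> a \<approx> sinv b \<otimes> b" and abK: "a \<otimes> sinv b \<in> K"
  shows "sinv a \<otimes> e \<otimes> a \<approx> sinv b \<otimes> e \<otimes> b"
proof -
  let ?k = "a \<otimes> sinv b"
  have ia: "sinv a \<otimes> e \<otimes> a \<in> idems S" and ib: "sinv b \<otimes> e \<otimes> b \<in> idems S"
    using a b e conj_idem' by auto
  have "sinv a \<otimes> e \<otimes> a = (sinv a \<otimes> a) \<otimes> (sinv a \<otimes> e \<otimes> a)"
    using a e by (simp add: mult_assoc mult_sinv_mult_left)
  also have "\<dots> \<approx> (sinv b \<otimes> b) \<otimes> (sinv a \<otimes> e \<otimes> a)" using t ia by (rule rel_mult_idem)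
  also have "\<dots> = (sinv b \<otimes> b) \<otimes> ((sinv b \<otimes> b) \<otimes> (sinv a \<otimes> e \<otimes> a))"
    using b ia by (simp only: idem_mult_self_left[OF sinv_mult_idem[OF b] idems_closed[OF ia]])
  also have "\<dots> = (sinv b \<otimes> b) \<otimes> ((sinv a \<otimes> e \<otimes> a) \<otimes> (sinv b \<otimes> b))"
    using b ia by (simp only: idem_commute[OF sinv_mult_idem[OF b] ia])
  also have "\<dots> = sinv b \<otimes> (sinv ?k \<otimes> e \<otimes> ?k) \<otimes> b"
    using a b e by (simp add: sinv_mult mult_assoc)
  also have "\<dots> \<approx> sinv b \<otimes> (sinv ?k \<otimes> ?k \<otimes> e) \<otimes> b"
    using abK e b by (intro rel_conj rel_conj_K)
  also have "\<dots> = (sinv b \<otimes> b) \<otimes> ((sinv a \<otimes> a) \<otimes> (sinv b \<otimes> e \<otimes> b))"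
    using a b e by (simp add: sinv_mult mult_assoc)
  also have "\<dots> = (sinv a \<otimes> a) \<otimes> ((sinv b \<otimes> b) \<otimes> (sinv b \<otimes> e \<otimes> b))"
    using a b ib by (intro idem_left_commute) auto
  also have "\<dots> = (sinv a \<otimes> a) \<otimes> (sinv b \<otimes> e \<otimes> b)"
    using a b e by (simp add: mult_assoc mult_sinv_mult_left)
  also have "\<dots> \<approx> (sinv b \<otimes> b) \<otimes> (sinv b \<otimes> e \<otimes> b)" using t ib by (rule rel_mult_idem)
  also have "\<dots> = sinv b \<otimes> e \<otimes> b" using b e by (simp add: mult_assoc mult_sinv_mult_left)
  finally show ?thesis .
qed

lemma pair_cong_iff: "(a, b) \<in> pair_cong S K \<tau> \<longleftrightarrow> a \<in> carrier S \<and> b \<in> carrier S \<and>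
    sinv a \<otimes> a \<approx> sinv b \<otimes> b \<and> a \<otimes> sinv b \<in> K"
  by (simp add: pair_cong_def related_def)

lemma equiv_pair_cong: "equiv (carrier S) (pair_cong S K \<tau>)"
proof (intro equivI refl_onI symI transI)
  show "pair_cong S K \<tau> \<subseteq> carrier S \<times> carrier S" unfolding pair_cong_def by blast
  show "(a, a) \<in> pair_cong S K \<tau>" if "a \<in> carrier S" for a
    using that rel_refl[OF sinv_mult_idem[OF that]] K_idem[OF mult_sinv_idem[OF that]]
    by (simp add: pair_cong_iff)
  show "(b, a) \<in> pair_cong S K \<tau>" if "(a, b) \<in> pair_cong S K \<tau>" for a b
    using that K_sinv[of "a \<otimes> sinv b"] rel_sym[of "sinv a \<otimes> a" "sinv b \<otimes> b"]
    by (simp add: pair_cong_iff sinv_mult)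
  fix a b c assume ab: "(a, b) \<in> pair_cong S K \<tau>" and bc: "(b, c) \<in> pair_cong S K \<tau>"
  hence cs: "a \<in> carrier S" "b \<in> carrier S" "c \<in> carrier S"
    and tab: "sinv a \<otimes> a \<approx> sinv b \<otimes> b" and tbc: "sinv b \<otimes> b \<approx> sinv c \<otimes> c"
    and k: "a \<otimes> sinv b \<in> K" "b \<otimes> sinv c \<in> K" by (simp_all add: pair_cong_iff)
  have "a \<otimes> (sinv b \<otimes> b) \<otimes> sinv c \<in> K"
    using K_mult[OF k] cs by (simp add: mult_assoc)
  hence "a \<otimes> sinv c \<in> K"
    using K_remove_idem rel_sym[OF tab] cs sinv_closed by blast
  thus "(a, c) \<in> pair_cong S K \<tau>" using cs rel_trans[OF tab tbc] by (simp add: pair_cong_iff)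
qed

lemma pair_cong_left:
  assumes ab: "(a, b) \<in> pair_cong S K \<tau>" and c: "c \<in> carrier S"
  shows "(c \<otimes> a, c \<otimes> b) \<in> pair_cong S K \<tau>"
proof -
  have cs: "a \<in> carrier S" "b \<in> carrier S" using ab by (auto simp: pair_cong_iff)
  have "sinv a \<otimes> (sinv c \<otimes> c) \<otimes> a \<approx> sinv b \<otimes> (sinv c \<otimes> c) \<otimes> b"
    using ab c by (intro rel_conj_pair) (auto simp: pair_cong_iff)
  moreover have "c \<otimes> (a \<otimes> sinv b) \<otimes> sinv c \<in> K"
    using ab c by (intro K_conj) (auto simp: pair_cong_iff)
  ultimately show ?thesis using cs c by (simp add: pair_cong_iff sinv_mult mult_assoc)
qed

lemma pair_cong_right:
  assumes ab: "(a, b) \<in> pair_cong S K \<tau>" and c: "c \<in> carrier S"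
  shows "(a \<otimes> c, b \<otimes> c) \<in> pair_cong S K \<tau>"
proof -
  have cs: "a \<in> carrier S" "b \<in> carrier S" using ab by (auto simp: pair_cong_iff)
  have "sinv c \<otimes> (sinv a \<otimes> a) \<otimes> c \<approx> sinv c \<otimes> (sinv b \<otimes> b) \<otimes> c"
    using ab c by (intro rel_conj) (auto simp: pair_cong_iff)
  moreover have "a \<otimes> (c \<otimes> sinv c) \<otimes> sinv b \<in> K"
    using ab c by (intro K_insert_idem) (auto simp: pair_cong_iff)
  ultimately show ?thesis using cs c by (simp add: pair_cong_iff sinv_mult mult_assoc)
qed

lemma semigroup_congruence_pair_cong: "semigroup_congruence S (pair_cong S K \<tau>)"
  unfolding semigroup_congruence_def
  using equiv_pair_cong pair_cong_left pair_cong_right by blast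

lemma kernel_pair_cong: "kernel_cong S (pair_cong S K \<tau>) = K"
proof (intro equalityI subsetI)
  fix a assume "a \<in> kernel_cong S (pair_cong S K \<tau>)"
  then obtain e where e: "e \<in> idems S" and ae: "(a, e) \<in> pair_cong S K \<tau>"
    unfolding kernel_cong_def by blast
  hence "a \<in> carrier S" "sinv a \<otimes> a \<approx> e" "a \<otimes> e \<in> K"
    by (simp_all add: pair_cong_iff idem_mult_self)
  thus "a \<in> K" using e by (blast intro: K_cancel rel_sym)
next
  fix a assume a: "a \<in> K"
  hence ac: "a \<in> carrier S" by simp
  note i = sinv_mult_idem[OF ac]
  have "(a, sinv a \<otimes> a) \<in> pair_cong S K \<tau>"
    using a ac rel_refl[OF i] idem_mult_self[OF i]
    by (simp add: pair_cong_iff sinv_idem[OF i] mult_sinv_mult)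
  thus "a \<in> kernel_cong S (pair_cong S K \<tau>)" using ac i unfolding kernel_cong_def by blast
qed

lemma trace_pair_cong: "trace_cong S (pair_cong S K \<tau>) = \<tau>"
proof -
  have "(e, f) \<in> pair_cong S K \<tau> \<longleftrightarrow> e \<approx> f" if "e \<in> idems S" "f \<in> idems S" for e f
    using that K_idem[OF idem_mult_idem[OF that]] by (simp add: pair_cong_iff idem_mult_self)
  thus ?thesis using rel_idem unfolding trace_cong_def related_def by auto
qed

end

section \<open>Maximum elements of the classes of the minimum group congruence\<close>

context inverse_semigroup
begin

text \<open>
  When the idempotent \<open>e\<close> witnesses \<open>a \<sigma> b\<close>, the conjugate \<open>c e c\<inverse>\<close> witnesses
  \<open>c a \<sigma> c b\<close>.
\<close>

lemma semigroup_congruence_min_group_cong: "semigroup_congruence S (min_group_cong S)"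
  unfolding semigroup_congruence_def
proof (intro conjI allI impI equivI refl_onI symI transI)
  show "min_group_cong S \<subseteq> carrier S \<times> carrier S" by (auto simp: min_group_cong_def)
  show "(a, a) \<in> min_group_cong S" if "a \<in> carrier S" for a
    unfolding min_group_cong_def using that sinv_mult_idem[OF that] by blast
  show "(b, a) \<in> min_group_cong S" if "(a, b) \<in> min_group_cong S" for a b
    using that by (force simp: min_group_cong_def)
  show "(a, c) \<in> min_group_cong S"
    if ab: "(a, b) \<in> min_group_cong S" and bc: "(b, c) \<in> min_group_cong S" for a b c
  proof -
    from ab bc obtain e f where *: "e \<in> idems S" "f \<in> idems S" "e \<otimes> a = e \<otimes> b" "f \<otimes> b = f \<otimes> c"
      and cs: "a \<in> carrier S" "b \<in> carrier S" "c \<in> carrier S" by (auto simp: min_group_cong_def)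
    have "f \<otimes> e \<otimes> a = f \<otimes> (e \<otimes> b)" using * cs by (simp add: mult_assoc)
    also have "\<dots> = e \<otimes> (f \<otimes> b)" using * cs by (intro idem_left_commute) auto
    also have "\<dots> = f \<otimes> (e \<otimes> c)" using * cs by (simp add: idem_left_commute)
    also have "\<dots> = f \<otimes> e \<otimes> c" using * cs by (simp add: mult_assoc)
    finally show ?thesis using * cs idem_mult_idem by (auto simp: min_group_cong_def)
  qed
next
  fix a b c assume "(a, b) \<in> min_group_cong S" and c: "c \<in> carrier S"
  then obtain e where e: "e \<in> idems S" "e \<otimes> a = e \<otimes> b" and cs: "a \<in> carrier S" "b \<in> carrier S"
    by (auto simp: min_group_cong_def)
  have push: "c \<otimes> e \<otimes> sinv c \<otimes> (c \<otimes> x) = c \<otimes> (e \<otimes> x)" if x: "x \<in> carrier S" for x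
  proof -
    have "c \<otimes> e \<otimes> sinv c \<otimes> (c \<otimes> x) = c \<otimes> e \<otimes> sinv c \<otimes> c \<otimes> x"
      using c e x by (simp add: mult_assoc)
    also have "\<dots> = c \<otimes> (e \<otimes> x)"
      using c e x by (simp add: idem_push_left) (simp add: mult_assoc)
    finally show ?thesis .
  qed
  have "c \<otimes> e \<otimes> sinv c \<otimes> (c \<otimes> a) = c \<otimes> e \<otimes> sinv c \<otimes> (c \<otimes> b)"
    using cs e by (simp add: push)
  thus "(c \<otimes> a, c \<otimes> b) \<in> min_group_cong S"
    using c cs conj_idem[OF c e(1)] by (auto simp: min_group_cong_def)
  have "e \<otimes> (a \<otimes> c) = e \<otimes> (b \<otimes> c)" using c cs e by (simp add: mult_assoc[symmetric])
  thus "(a \<otimes> c, b \<otimes> c) \<in> min_group_cong S" using c cs e by (auto simp: min_group_cong_def)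
qed

lemma nat_le_antisym:
  assumes st: "nat_le S s t" and ts: "nat_le S t s" and cs: "s \<in> carrier S" "t \<in> carrier S"
  shows "s = t"
proof -
  from st ts obtain e f where e: "e \<in> idems S" "s = e \<otimes> t" and f: "f \<in> idems S" "t = f \<otimes> s"
    unfolding nat_le_def by auto
  have "s = e \<otimes> (f \<otimes> s)" by (fold f(2)) (rule e(2))
  also have "\<dots> = f \<otimes> (e \<otimes> s)" using e f cs by (intro idem_left_commute) auto
  also have "e \<otimes> s = s"
    unfolding e(2) by (rule idem_mult_self_left[OF e(1) cs(2)])
  finally show ?thesis by (fold f(2))
qed

end

sublocale inverse_semigroup \<subseteq> sigma: inverse_semigroup_cong S "min_group_cong S"
  by unfold_locales (rule semigroup_congruence_min_group_cong)

context inverse_semigroup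
begin

lemmas sigma_carrier = sigma.rel_carrier[unfolded sigma.related_def]
lemmas sigma_sym = sigma.rel_sym[unfolded sigma.related_def]
lemmas sigma_trans = sigma.rel_trans[unfolded sigma.related_def]
lemmas sigma_mult = sigma.rel_mult[unfolded sigma.related_def]

end

context F_inverse_monoid
begin

lemma is_max_cmax:
  assumes a: "a \<in> carrier S"
  shows "is_max_of_class S a (cmax S a)"
proof -
  have "\<exists>!m. is_max_of_class S a m"
  proof (rule ex_ex1I[OF ex_max[OF a]])
    fix m n assume "is_max_of_class S a m" "is_max_of_class S a n"
    thus "m = n" unfolding is_max_of_class_def using sigma_carrier
      by (intro nat_le_antisym) blast+
  qed
  from theI'[OF this] show ?thesis unfolding cmax_def .
qed

lemma cmax_sigma: "a \<in> carrier S \<Longrightarrow> (a, cmax S a) \<in> min_group_cong S"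
  using is_max_cmax unfolding is_max_of_class_def by blast

lemma le_cmax: "(b, a) \<in> min_group_cong S \<Longrightarrow> nat_le S b (cmax S a)"
  using is_max_cmax[of a] sigma_carrier sigma_sym unfolding is_max_of_class_def by blast

lemma cmax_closed [simp, intro]: "a \<in> carrier S \<Longrightarrow> cmax S a \<in> carrier S"
  using cmax_sigma sigma_carrier by blast

lemma one_idem: "\<one> \<in> idems S"
  by (simp add: idems_def del: idems_closed)

lemma idem_sigma_one:
  assumes e: "e \<in> idems S"
  shows "(e, \<one>) \<in> min_group_cong S"
proof -
  have "e \<otimes> e = e \<otimes> \<one>" using e by (simp add: idem_mult_self)
  thus ?thesis using e by (auto simp: min_group_cong_def)
qed

text \<open>
  The maximum \<open>m\<close> of the class of the idempotents satisfies \<open>1 = f m\<close> for some idempotent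
  \<open>f\<close>; multiplying by \<open>f\<close> gives \<open>f = 1\<close>.
\<close>

lemma cmax_idem:
  assumes e: "e \<in> idems S"
  shows "cmax S e = \<one>"
proof -
  obtain f where f: "f \<in> idems S" "\<one> = f \<otimes> cmax S e"
    using le_cmax[OF sigma_sym[OF idem_sigma_one[OF e]]] unfolding nat_le_def by blast
  have "f = f \<otimes> (f \<otimes> cmax S e)" using arg_cong[OF f(2), of "\<lambda>x. f \<otimes> x"] f(1) by simp
  also have "\<dots> = \<one>" using f e by (simp only: idem_mult_self_left cmax_closed idems_closed)
  finally have "f = \<one>" .
  have "\<one> = f \<otimes> cmax S e" by (rule f(2))
  also note \<open>f = \<one>\<close>
  finally have "\<one> = \<one> \<otimes> cmax S e" .
  thus ?thesis using e by simp
qed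

end

section \<open>F-congruences and F-congruence pairs\<close>

locale F_inverse_monoid_cong = F_inverse_monoid S + inverse_semigroup_cong S \<rho>
  for S :: "('a, 'b) monoid_scheme" (structure) and \<rho> :: "('a \<times> 'a) set"
begin

text \<open>
  An element related to an idempotent \<open>e\<close> has its maximum related to \<open>e\<^sup>\<mm> = 1\<close>.
\<close>

lemma F_congruence_imp_pair:
  assumes F: "F_congruence S \<rho>"
  shows "F_congruence_pair S (kernel_cong S \<rho>) (trace_cong S \<rho>)"
proof -
  have one: "cmax S a \<approx> \<one>" if "a \<in> kernel_cong S \<rho>" for a
    using that F by (metis F_congruence_def cmax_idem kernelE related_def)
  have "cmax S a \<in> kernel_cong S \<rho>" if "a \<in> kernel_cong S \<rho>" for a
    using one[OF that] one_idem by (rule kernelI)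
  moreover have "(sinv (cmax S a) \<otimes> cmax S a, \<one>) \<in> trace_cong S \<rho>"
    if "a \<in> kernel_cong S \<rho>" for a
    using rel_sinv_mult[OF one[OF that]] one_idem rel_carrier[OF one[OF that]]
    by (simp add: trace_iff)
  ultimately show ?thesis
    using congruence_pair_kernel_trace by (simp add: F_congruence_pair_def)
qed

text \<open>
  The element \<open>g = (a b\<inverse>)\<^sup>\<mm>\<close> lies in the kernel and has domain idempotent related to \<open>1\<close>, so
  \<open>g \<rho> 1\<close> and \<open>b\<^sup>\<mm> \<rho> g b\<^sup>\<mm>\<close>.  As \<open>g b\<^sup>\<mm>\<close> lies in the \<open>\<sigma>\<close>-class of \<open>a\<close>, it is below \<open>a\<^sup>\<mm>\<close>.
\<close>

lemma cmax_below:
  assumes F: "F_congruence_pair S (kernel_cong S \<rho>) (trace_cong S \<rho>)" and ab: "a \<approx> b"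
  obtains e where "e \<in> idems S" "cmax S b \<approx> e \<otimes> cmax S a"
proof -
  have a: "a \<in> carrier S" and b: "b \<in> carrier S" using rel_carrier[OF ab] by auto
  define g where "g = cmax S (a \<otimes> sinv b)"
  have gc: "g \<in> carrier S" using a b by (simp add: g_def)
  have "a \<otimes> sinv b \<approx> b \<otimes> sinv b" using ab b by (intro rel_mult) auto
  hence "a \<otimes> sinv b \<in> kernel_cong S \<rho>" using b by (intro kernelI) auto
  with F have gK: "g \<in> kernel_cong S \<rho>" and g1: "sinv g \<otimes> g \<approx> \<one>"
    unfolding F_congruence_pair_def g_def by (auto simp: trace_iff)
  from gK obtain f where f: "f \<in> idems S" "g \<approx> f" by (auto elim: kernelE)
  have "g \<approx> f" by fact
  also have "f \<approx> sinv g \<otimes> g"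
    using rel_sym[OF rel_sinv_mult[OF f(2)]] f(1) by (simp add: idem_mult_self)
  also note g1
  finally have g: "g \<approx> \<one>" .
  \<comment> \<open>In the group \<open>S / \<sigma>\<close>, the product \<open>(a b\<inverse>) b\<close> is \<open>a\<close>.\<close>
  have "(a \<otimes> (sinv b \<otimes> b), a \<otimes> \<one>) \<in> min_group_cong S"
    using sigma.rel_refl[OF a] idem_sigma_one[OF sinv_mult_idem[OF b]]
    unfolding sigma.related_def by (rule sigma_mult)
  hence aba: "(a \<otimes> sinv b \<otimes> b, a) \<in> min_group_cong S"
    using a b by (simp add: mult_assoc)
  have "(g \<otimes> cmax S b, a \<otimes> sinv b \<otimes> b) \<in> min_group_cong S"
    unfolding g_def using a b by (intro sigma_mult sigma_sym[OF cmax_sigma]) auto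
  hence "(g \<otimes> cmax S b, a) \<in> min_group_cong S" using aba by (rule sigma_trans)
  from le_cmax[OF this] obtain e where e: "e \<in> idems S" "g \<otimes> cmax S b = e \<otimes> cmax S a"
    unfolding nat_le_def by auto
  have "g \<otimes> cmax S b \<approx> \<one> \<otimes> cmax S b" using g b by (intro rel_mult) auto
  hence "cmax S b \<approx> e \<otimes> cmax S a" using b e by (auto intro: rel_sym)
  thus ?thesis using e that by blast
qed

text \<open>Antisymmetry of the natural partial order on \<open>S / \<rho>\<close>, applied to \<open>cmax_below\<close>.\<close>

lemma pair_imp_F_congruence:
  assumes F: "F_congruence_pair S (kernel_cong S \<rho>) (trace_cong S \<rho>)"
  shows "F_congruence S \<rho>"
  unfolding F_congruence_def
proof (intro conjI allI impI cong)
  fix a b assume "(a, b) \<in> \<rho>"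
  hence ab: "a \<approx> b" by (simp add: related_def)
  define c d where "c = cmax S a" and "d = cmax S b"
  have cd: "c \<in> carrier S" "d \<in> carrier S" using rel_carrier[OF ab] by (auto simp: c_def d_def)
  obtain e where e: "e \<in> idems S" "d \<approx> e \<otimes> c"
    using cmax_below[OF F ab] unfolding c_def d_def .
  obtain f where f: "f \<in> idems S" "c \<approx> f \<otimes> d"
    using cmax_below[OF F rel_sym[OF ab]] unfolding c_def d_def .
  have "e \<otimes> d \<approx> e \<otimes> (e \<otimes> c)" using e by (intro rel_mult) auto
  also have "\<dots> = e \<otimes> c" using e cd by (simp add: idem_mult_self_left)
  also have "\<dots> \<approx> d" using e by (auto intro: rel_sym)
  finally have ed: "e \<otimes> d \<approx> d" .
  note f(2)
  also have "f \<otimes> d \<approx> f \<otimes> (e \<otimes> d)" using f rel_sym[OF ed] by (intro rel_mult) auto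
  also have "\<dots> = e \<otimes> (f \<otimes> d)" using e f cd by (intro idem_left_commute) auto
  also have "\<dots> \<approx> e \<otimes> c" using e rel_sym[OF f(2)] by (intro rel_mult) auto
  also have "\<dots> \<approx> d" using e by (auto intro: rel_sym)
  finally show "(cmax S a, cmax S b) \<in> \<rho>" by (simp add: c_def d_def related_def)
qed

end

theorem theorem3p10:
  fixes S :: "('a, 'b) monoid_scheme"
  assumes "F_inverse_monoid S"
  shows "(\<forall>\<rho>. semigroup_congruence S \<rho> \<longrightarrow>
            (F_congruence S \<rho> \<longleftrightarrow> F_congruence_pair S (kernel_cong S \<rho>) (trace_cong S \<rho>)))
    \<and> bij_betw (\<lambda>\<rho>. (kernel_cong S \<rho>, trace_cong S \<rho>))
        {\<rho>. F_congruence S \<rho>} {(K, \<tau>). F_congruence_pair S K \<tau>}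
    \<and> (\<forall>\<rho>. F_congruence S \<rho> \<longrightarrow> pair_cong S (kernel_cong S \<rho>) (trace_cong S \<rho>) = \<rho>)
    \<and> (\<forall>K \<tau>. F_congruence_pair S K \<tau> \<longrightarrow>
         F_congruence S (pair_cong S K \<tau>)
         \<and> kernel_cong S (pair_cong S K \<tau>) = K \<and> trace_cong S (pair_cong S K \<tau>) = \<tau>)"
proof -
  interpret F_inverse_monoid S by fact
  have cong: "F_inverse_monoid_cong S \<rho>" if "semigroup_congruence S \<rho>" for \<rho>
    using that by unfold_locales
  have iff: "F_congruence S \<rho> \<longleftrightarrow> F_congruence_pair S (kernel_cong S \<rho>) (trace_cong S \<rho>)"
    if "semigroup_congruence S \<rho>" for \<rho>
    using F_inverse_monoid_cong.F_congruence_imp_pair[OF cong[OF that]]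
      F_inverse_monoid_cong.pair_imp_F_congruence[OF cong[OF that]] by blast
  have left: "pair_cong S (kernel_cong S \<rho>) (trace_cong S \<rho>) = \<rho>" if "F_congruence S \<rho>" for \<rho>
  proof -
    interpret inverse_semigroup_cong S \<rho>
      using that by unfold_locales (simp add: F_congruence_def)
    show ?thesis by (rule pair_cong_kernel_trace)
  qed
  have right: "F_congruence S (pair_cong S K \<tau>) \<and> kernel_cong S (pair_cong S K \<tau>) = K
      \<and> trace_cong S (pair_cong S K \<tau>) = \<tau>" if F: "F_congruence_pair S K \<tau>" for K \<tau>
  proof -
    interpret inverse_semigroup_pair S K \<tau>
      using F by unfold_locales (simp add: F_congruence_pair_def)
    show ?thesis
      using iff[OF semigroup_congruence_pair_cong] F kernel_pair_cong trace_pair_cong by simp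
  qed
  have "bij_betw (\<lambda>\<rho>. (kernel_cong S \<rho>, trace_cong S \<rho>))
        {\<rho>. F_congruence S \<rho>} {(K, \<tau>). F_congruence_pair S K \<tau>}"
    by (rule bij_betwI[where g = "\<lambda>(K, \<tau>). pair_cong S K \<tau>"])
      (use iff left right in \<open>auto simp: F_congruence_def\<close>)
  with iff left right show ?thesis by blast
qed

end
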